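(* Let $q$ be a prime power and let $n,k,l$ be positive integers such that $2\le k\le n$. Then the function $\mathbb F_{q^n}\to\mathbb F_{q^n}$, $$x\mapsto x^{(q-1)(1+q^l+q^{2l}+\cdots+q^{(k-1)l})},$$ is $k$th order sum-free on $\mathbb F_{q^n}$ if and only if $\gcd(l,n)=1$.
   Context: A function $f:\mathbb F_{q^n}\to\mathbb F_{q^n}$ is called $k$th order sum-free if for every $k$-dimensional $\mathbb F_q$-affine subspace $A$ of $\mathbb F_{q^n}$ (i.e. a coset of a $k$-dimensional $\mathbb F_q$-linear subspace) one has $\sum_{x\in A}f(x)\neq 0$. *)

theory Defs
  imports "HOL-Library.Cardinality" "HOL-Computational_Algebra.Computational_Algebra" "HOL-Number_Theory.Prime_Powers"
begin

text \<open>
  The extension \<open>F\<^sub>q \<subseteq> F\<^sub>q\<^sub>n\<close> is given by a unital ring homomorphism \<open>\<iota>\<close> between two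
  field types (automatically injective). The larger field is an
  \<open>F\<^sub>q\<close>-vector space through \<open>\<iota>\<close>, so that subspaces and dimensions over \<open>F\<^sub>q\<close> are the ones
  of the library locales \<^locale>\<open>module\<close> and \<^locale>\<open>vector_space\<close>.
\<close>

definition field_embedding :: "('a::field \<Rightarrow> 'b::field) \<Rightarrow> bool" where
  "field_embedding \<iota> \<longleftrightarrow>
     \<iota> 1 = 1 \<and> (\<forall>x y. \<iota> (x + y) = \<iota> x + \<iota> y) \<and> (\<forall>x y. \<iota> (x * y) = \<iota> x * \<iota> y)"

definition ext_scale :: "('a::field \<Rightarrow> 'b::field) \<Rightarrow> 'a \<Rightarrow> 'b \<Rightarrow> 'b" where
  "ext_scale \<iota> c x = \<iota> c * x"

lemma vector_space_ext_scale:
  assumes "field_embedding \<iota>"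
  shows "vector_space (ext_scale \<iota>)"
  using assms by unfold_locales (auto simp: field_embedding_def ext_scale_def algebra_simps)

definition affine_subspace_of_dim ::
    "('a::field \<Rightarrow> 'b::field) \<Rightarrow> nat \<Rightarrow> 'b set \<Rightarrow> bool" where
  "affine_subspace_of_dim \<iota> k A \<longleftrightarrow>
     (\<exists>V a. module.subspace (ext_scale \<iota>) V \<and> vector_space.dim (ext_scale \<iota>) V = k \<and>
            A = (\<lambda>v. a + v) ` V)"

definition order_sum_free ::
    "('a::field \<Rightarrow> 'b::{field,finite}) \<Rightarrow> nat \<Rightarrow> ('b \<Rightarrow> 'b) \<Rightarrow> bool" where
  "order_sum_free \<iota> k f \<longleftrightarrow> (\<forall>A. affine_subspace_of_dim \<iota> k A \<longrightarrow> (\<Sum>x\<in>A. f x) \<noteq> 0)"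

end

theory Submission
  imports Defs
begin

text \<open>
  Write \<open>\<sigma> x = x ^ (q ^ l)\<close>, so that the function in question is the product of the
  \<open>(\<sigma>\<^sup>i x) ^ (q - 1)\<close> for \<open>i < k\<close>, a polynomial of degree \<open>k * (q - 1)\<close> in the
  \<open>F\<^sub>q\<close>-coordinates of \<open>x\<close>. Polynomials of smaller degree sum to zero over every
  \<open>k\<close>-dimensional affine subspace. Since \<open>L ^ q\<close> is again \<open>F\<^sub>q\<close>-affine when \<open>L\<close> is, replacing
  \<open>M\<close> by \<open>M - L\<close> in \<open>L ^ (q - 1) * M ^ (q - 1)\<close> changes the product only by terms of lower degree,
  so each \<open>\<sigma>\<^sup>i\<^sup>+\<^sup>1\<close> may be replaced by \<open>\<sigma>\<^sup>i \<circ> \<tau>\<close> with \<open>\<tau> = \<sigma> - id\<close>.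
  As \<open>\<tau> 1 = 0\<close>, summing first along the direction \<open>1\<close> reduces the sum over \<open>a + (F\<^sub>q \<oplus> W)\<close> to
  minus the corresponding sum, for \<open>k - 1\<close>, of the values at \<open>\<tau> (a + y)\<close> for \<open>y \<in> W\<close>.
  If \<open>gcd l n = 1\<close>, then \<open>ker \<tau> = F\<^sub>q\<close>, so \<open>\<tau>\<close> is injective on \<open>W\<close> and induction on \<open>k\<close>
  (after scaling a basis vector to \<open>1\<close>) gives a nonzero sum. Otherwise some \<open>t \<notin> F\<^sub>q\<close> has
  \<open>\<tau> t = 0\<close>, and with \<open>t \<in> W\<close> every term is repeated \<open>q\<close> times, so the sum vanishes.
\<close>

section \<open>Power sums over a finite field\<close>

lemma finite_field_power_card_minus_1:
  fixes x :: "'a::{field,finite}"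
  assumes "x \<noteq> 0"
  shows "x ^ (CARD('a) - 1) = 1"
proof -
  have "(\<Prod>y\<in>UNIV-{0}. x * y) = (\<Prod>y\<in>UNIV-{0}. y)"
    by (rule prod.reindex_bij_witness[of _ "\<lambda>y. y / x" "\<lambda>y. x * y"]) (use assms in auto)
  then have "x ^ (CARD('a) - 1) * \<Prod>(UNIV-{0}) = \<Prod>(UNIV-{0})"
    by (simp add: prod.distrib)
  moreover have "\<Prod>(UNIV-{0::'a}) \<noteq> 0"
    by simp
  ultimately show ?thesis by simp
qed

lemma of_nat_card_eq_0: "of_nat (CARD('a)) = (0::'a::{ring_1,finite})"
proof -
  have "(\<Sum>x\<in>(UNIV::'a set). x) = (\<Sum>x\<in>UNIV. x + 1)"
    by (rule sum.reindex_bij_witness[of _ "\<lambda>x. x + 1" "\<lambda>x. x - 1"]) auto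
  then show ?thesis
    by (simp add: sum.distrib)
qed

lemma exists_power_neq_1:
  assumes "0 < m" "m < CARD('a::{field,finite}) - 1"
  shows "\<exists>g::'a. g \<noteq> 0 \<and> g ^ m \<noteq> 1"
proof (rule ccontr)
  assume "\<not> ?thesis"
  then have sub: "UNIV - {0} \<subseteq> {x::'a. poly (monom 1 m - 1) x = 0}"
    by (auto simp: poly_monom)
  have c: "coeff (monom (1::'a) m - 1) m = 1"
    using assms(1) by simp
  then have "monom (1::'a) m - 1 \<noteq> 0"
    by (metis coeff_0 zero_neq_one)
  then have "card {x::'a. poly (monom 1 m - 1) x = 0} \<le> degree (monom (1::'a) m - 1)"
    by (rule card_poly_roots_bound)
  also have "\<dots> \<le> m"
    by (intro degree_diff_le) (auto simp: degree_monom_le)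
  finally have "card (UNIV - {0::'a}) \<le> m"
    using card_mono[OF _ sub] by simp
  then show False using assms(2) by simp
qed

text \<open>Scaling by some \<open>g\<close> with \<open>g ^ m \<noteq> 1\<close> permutes the field
  and multiplies the sum by \<open>g ^ m\<close>. For \<open>m = 0\<close> every term is
  \<open>1\<close>, also at \<open>x = 0\<close>, and the cardinality is zero in the field.\<close>

lemma sum_power_finite_field:
  assumes "m < CARD('a::{field,finite}) - 1"
  shows "(\<Sum>x\<in>(UNIV::'a set). x ^ m) = 0"
proof (cases "m = 0")
  case True
  then show ?thesis by (simp add: of_nat_card_eq_0)
next
  case False
  then obtain g :: 'a where g: "g \<noteq> 0" "g ^ m \<noteq> 1"
    using exists_power_neq_1 assms by blast
  have "(\<Sum>x\<in>(UNIV::'a set). x ^ m) = (\<Sum>x\<in>(UNIV::'a set). (g * x) ^ m)"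
    by (rule sum.reindex_bij_witness[of _ "\<lambda>y. g * y" "\<lambda>y. y / g"]) (use g in auto)
  also have "\<dots> = g ^ m * (\<Sum>x\<in>(UNIV::'a set). x ^ m)"
    by (simp add: power_mult_distrib sum_distrib_left)
  finally show ?thesis using g(2) by simp
qed

lemma sum_power_card_minus_1:
  "(\<Sum>x\<in>(UNIV::'a::{field,finite} set). x ^ (CARD('a) - 1)) = -1"
proof -
  have "CARD('a) > 1"
    by (metis One_nat_def Suc_lessI UNIV_I card_1_singletonE finite_UNIV_card_ge_0 finite
        singletonD zero_neq_one)
  then have "(\<Sum>x\<in>(UNIV::'a set). x ^ (CARD('a) - 1)) = (\<Sum>x\<in>UNIV - {0::'a}. x ^ (CARD('a) - 1))"
    by (intro sum.mono_neutral_right) auto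
  also have "\<dots> = of_nat (CARD('a) - 1)"
    by (subst sum.cong[OF refl finite_field_power_card_minus_1]) auto
  also have "\<dots> = -1"
    using of_nat_card_eq_0[where 'a='a] \<open>CARD('a) > 1\<close> by (simp add: of_nat_diff)
  finally show ?thesis .
qed

section \<open>The extension as a vector space, and its Frobenius map\<close>

locale finite_extension =
  fixes \<iota> :: "'a::{field,finite} \<Rightarrow> 'b::{field,finite}" and q :: nat
  assumes emb: "field_embedding \<iota>" and primepow_q: "primepow q" and q: "CARD('a) = q"
begin

sublocale vector_space "ext_scale \<iota>"
  by (rule vector_space_ext_scale[OF emb])

sublocale vector_space_pair "ext_scale \<iota>" "ext_scale \<iota>" ..

lemma emb_1 [simp]: "\<iota> 1 = 1" and emb_add: "\<iota> (x + y) = \<iota> x + \<iota> y"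
  and emb_mult: "\<iota> (x * y) = \<iota> x * \<iota> y"
  using emb by (auto simp: field_embedding_def)

lemma emb_0 [simp]: "\<iota> 0 = 0"
  by (metis add_cancel_right_right add_0 emb_add)

lemma emb_minus: "\<iota> (- x) = - \<iota> x"
  using emb_add[of x "- x"] by (simp add: add_eq_0_iff)

lemma emb_power: "\<iota> (x ^ m) = \<iota> x ^ m"
  by (induction m) (auto simp: emb_mult)

lemma emb_sum: "\<iota> (sum f A) = (\<Sum>x\<in>A. \<iota> (f x))"
  by (induction A rule: infinite_finite_induct) (auto simp: emb_add)

lemma emb_of_nat: "\<iota> (of_nat m) = of_nat m"
  by (induction m) (auto simp: emb_add)

lemma inj_emb: "inj \<iota>"
proof (rule injI)
  fix x y assume "\<iota> x = \<iota> y"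
  then have "\<iota> (x - y) = 0"
    using emb_add[of x "- y"] by (simp add: emb_minus)
  then have "x - y = 0"
    using emb_mult[of "x - y" "inverse (x - y)"] by (cases "x - y = 0") auto
  then show "x = y" by simp
qed

lemma q_gt_1: "q > 1"
  using primepow_gt_Suc_0[OF primepow_q] by simp

lemma of_nat_q [simp]: "of_nat q = (0::'b)"
  using of_nat_card_eq_0[where 'a='a] emb_of_nat[of q] by (simp add: q)

lemma emb_power_q: "\<iota> c ^ q = \<iota> c"
proof (cases "c = 0")
  case False
  have "c ^ q = c * c ^ (q - 1)"
    using q_gt_1 by (metis less_imp_Suc_add diff_Suc_1 power_Suc add_Suc)
  then have "c ^ q = c"
    using finite_field_power_card_minus_1[OF False] by (simp add: q)
  then show ?thesis by (metis emb_power)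
qed (use q_gt_1 in auto)

lemma emb_power_q_power: "\<iota> c ^ (q ^ m) = \<iota> c"
  by (induction m) (auto simp: power_mult emb_power_q)

text \<open>The characteristic of \<open>'b\<close> is a prime dividing the prime power
  \<open>q\<close>, so \<open>q\<close> is a power of it.\<close>

lemma power_q_add: "(x + y :: 'b) ^ q = x ^ q + y ^ q"
proof -
  obtain r e where re: "prime r" "q = r ^ e"
    using primepow_q by (auto simp: primepow_def)
  have pr: "prime CHAR('b)"
    using finite_imp_CHAR_pos[where 'a='b] by (intro prime_CHAR_semidom) simp
  have "CHAR('b) dvd q"
    using of_nat_q of_nat_eq_0_iff_char_dvd by blast
  then have "CHAR('b) dvd r"
    using pr prime_dvd_power re(2) by blast
  then have "CHAR('b) = r"
    using pr re(1) by (simp add: primes_dvd_imp_eq)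
  then show ?thesis
    using freshmans_dream'[OF pr] re(2) by metis
qed

lemma power_q_power_add: "(x + y :: 'b) ^ (q ^ m) = x ^ (q ^ m) + y ^ (q ^ m)"
  by (induction m) (auto simp: power_mult power_q_add power_Suc2 simp del: power_Suc)

lemma sum_emb_power: "m < q - 1 \<Longrightarrow> (\<Sum>c\<in>UNIV. \<iota> c ^ m) = 0"
  using emb_sum[of "\<lambda>c. c ^ m" UNIV] by (simp add: sum_power_finite_field q emb_power)

lemma sum_emb_power_q_minus_1: "(\<Sum>c\<in>UNIV. \<iota> c ^ (q - 1)) = -1"
  using emb_sum[of "\<lambda>c. c ^ (q - 1)" UNIV] sum_power_card_minus_1[where 'a='a]
  by (simp add: q emb_power emb_minus)

text \<open>Only the top power of \<open>\<iota> c\<close> in the binomial expansion survives the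
  summation, and its coefficient is free of \<open>z\<close>.\<close>

lemma sum_emb_shift_power: "(\<Sum>c\<in>UNIV. (z + \<iota> c) ^ (q - 1)) = -1"
proof -
  have "(\<Sum>c\<in>UNIV. (z + \<iota> c) ^ (q - 1))
      = (\<Sum>c\<in>UNIV. \<Sum>m\<le>q-1. of_nat ((q - 1) choose m) * \<iota> c ^ m * z ^ (q - 1 - m))"
    by (simp add: binomial_ring add.commute[of z])
  also have "\<dots> = (\<Sum>m\<le>q-1. of_nat ((q - 1) choose m) * z ^ (q - 1 - m) * (\<Sum>c\<in>UNIV. \<iota> c ^ m))"
    by (subst sum.swap) (simp add: sum_distrib_left sum_distrib_right mult_ac)
  also have "\<dots> = (\<Sum>m\<le>q-1. if m = q - 1 then -1 else 0)"
    by (rule sum.cong) (auto simp: sum_emb_power simp flip: One_nat_def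
        intro: sum_emb_power_q_minus_1)
  finally show ?thesis by simp
qed

section \<open>Summation over spans, one basis vector at a time\<close>

lemma span_insert_bij:
  assumes "independent (insert v B)" "v \<notin> B"
  shows "bij_betw (\<lambda>(c, y). \<iota> c * v + y) (UNIV \<times> span B) (span (insert v B))"
proof -
  have v: "v \<notin> span B"
    using assms by (simp add: independent_insert)
  have "inj_on (\<lambda>(c, y). \<iota> c * v + y) (UNIV \<times> span B)"
  proof (rule inj_onI, clarify)
    fix c y d z
    assume yz: "y \<in> span B" "z \<in> span B" and eq: "\<iota> c * v + y = \<iota> d * v + z"
    have "\<iota> (c - d) * v = z - y"
      using eq emb_add[of c "-d"] by (simp add: emb_minus left_diff_distrib) (simp add: algebra_simps)
    then have mem: "ext_scale \<iota> (c - d) v \<in> span B"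
      using span_diff[OF yz(2,1)] by (simp add: ext_scale_def)
    have "c = d"
    proof (rule ccontr)
      assume "c \<noteq> d"
      then have "v \<in> span B"
        using span_scale[OF mem, of "inverse (c - d)"] by simp
      with v show False by simp
    qed
    with eq show "c = d \<and> y = z" by simp
  qed
  moreover have "(\<lambda>(c, y). \<iota> c * v + y) ` (UNIV \<times> span B) = span (insert v B)"
  proof (intro equalityI subsetI)
    fix x assume "x \<in> span (insert v B)"
    then obtain k where "x - \<iota> k * v \<in> span B"
      by (auto simp: span_breakdown_eq ext_scale_def)
    then show "x \<in> (\<lambda>(c, y). \<iota> c * v + y) ` (UNIV \<times> span B)"
      by (intro image_eqI[of _ _ "(k, x - \<iota> k * v)"]) auto
  next
    fix x assume "x \<in> (\<lambda>(c, y). \<iota> c * v + y) ` (UNIV \<times> span B)"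
    then obtain c y where "x = \<iota> c * v + y" "y \<in> span B" by auto
    then show "x \<in> span (insert v B)"
      by (auto simp: span_breakdown_eq ext_scale_def intro!: exI[of _ c])
  qed
  ultimately show ?thesis by (simp add: bij_betw_def)
qed

lemma sum_span_insert:
  fixes g :: "'b \<Rightarrow> 'c::comm_monoid_add"
  assumes "independent (insert v B)" "v \<notin> B"
  shows "(\<Sum>x\<in>span (insert v B). g x) = (\<Sum>c\<in>UNIV. \<Sum>y\<in>span B. g (\<iota> c * v + y))"
  using sum.reindex_bij_betw[OF span_insert_bij[OF assms], of g]
  by (simp add: sum.cartesian_product case_prod_unfold)

lemma card_span:
  assumes "independent B"
  shows "card (span B) = q ^ card B"
  using finite[of B] assms
proof (induction B rule: finite_induct)
  case (insert v B)
  then have "independent B" by (simp add: independent_insert)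
  then show ?case
    using sum_span_insert[of v B "\<lambda>_. 1::nat"] insert by (simp add: q)
qed simp

section \<open>Affine functions and degree\<close>

text \<open>\<open>M\<close> is the linear part of \<open>L\<close>; its additivity and homogeneity
  follow from the equation.\<close>

definition fq_affine :: "('b \<Rightarrow> 'b) \<Rightarrow> bool" where
  "fq_affine L \<longleftrightarrow> (\<exists>M. \<forall>x c v. L (x + \<iota> c * v) = L x + \<iota> c * M v)"

lemma fq_affine_id: "fq_affine (\<lambda>x. x)"
  unfolding fq_affine_def by (intro exI[of _ "\<lambda>x. x"]) simp

lemma fq_affine_add: "fq_affine L \<Longrightarrow> fq_affine M \<Longrightarrow> fq_affine (\<lambda>x. L x + M x)"
  unfolding fq_affine_def
  by (elim exE, rule_tac x="\<lambda>v. Ma v + Maa v" in exI) (simp add: algebra_simps)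

lemma fq_affine_minus: "fq_affine L \<Longrightarrow> fq_affine (\<lambda>x. - L x)"
  unfolding fq_affine_def
  by clarify (rule_tac x="\<lambda>v. - M v" in exI, simp add: algebra_simps)

lemma fq_affine_diff: "fq_affine L \<Longrightarrow> fq_affine M \<Longrightarrow> fq_affine (\<lambda>x. L x - M x)"
  using fq_affine_add[OF _ fq_affine_minus] by simp

lemma fq_affine_shift: "fq_affine L \<Longrightarrow> fq_affine (\<lambda>x. L (a + x))"
  unfolding fq_affine_def by (metis add.assoc)

lemma fq_affine_power: "fq_affine L \<Longrightarrow> fq_affine (\<lambda>x. L x ^ (q ^ m))"
  unfolding fq_affine_def
  by clarify (rule_tac x="\<lambda>v. M v ^ (q ^ m)" in exI,
      simp add: power_q_power_add power_mult_distrib emb_power_q_power)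

text \<open>An upper bound for the total degree in the \<open>F\<^sub>q\<close>-coordinates of the argument; by
  \<open>fq_affine_power\<close>, Frobenius powers do not increase it.\<close>

inductive deg_le :: "nat \<Rightarrow> ('b \<Rightarrow> 'b) \<Rightarrow> bool" where
  const: "deg_le d (\<lambda>_. c)"
| add: "deg_le d g \<Longrightarrow> deg_le d h \<Longrightarrow> deg_le d (\<lambda>x. g x + h x)"
| affine: "fq_affine L \<Longrightarrow> deg_le d g \<Longrightarrow> deg_le (Suc d) (\<lambda>x. L x * g x)"

lemma deg_le_affine: "fq_affine L \<Longrightarrow> deg_le 1 L"
  using deg_le.affine[OF _ deg_le.const[of 0 1]] by simp

lemma deg_le_mult: "deg_le d g \<Longrightarrow> deg_le e h \<Longrightarrow> deg_le (d + e) (\<lambda>x. g x * h x)"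
proof (induction arbitrary: e h rule: deg_le.induct)
  case (const d c)
  then show ?case
  proof (induction rule: deg_le.induct)
    case (const e c')
    then show ?case using deg_le.const[of _ "c * c'"] by simp
  next
    case (add e g h)
    then show ?case using deg_le.add by (simp add: algebra_simps)
  next
    case (affine L e g)
    then show ?case using deg_le.affine[of L "d + e" "\<lambda>x. c * g x"] by (simp add: mult_ac)
  qed
next
  case (add d g g')
  then show ?case using deg_le.add by (simp add: distrib_right)
next
  case (affine L d g)
  then show ?case using deg_le.affine[OF affine.hyps(1) affine.IH[OF affine.prems]]
    by (simp add: mult.assoc)
qed

lemma deg_le_power: "deg_le d g \<Longrightarrow> deg_le (m * d) (\<lambda>x. g x ^ m)"
  by (induction m) (auto intro: deg_le.const deg_le_mult)

lemma deg_le_prod: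
  "finite A \<Longrightarrow> (\<And>i. i \<in> A \<Longrightarrow> deg_le d (g i)) \<Longrightarrow> deg_le (card A * d) (\<lambda>x. \<Prod>i\<in>A. g i x)"
  by (induction A rule: finite_induct) (auto intro: deg_le.const deg_le_mult)

lemma deg_le_sum:
  "(\<And>i. i \<in> A \<Longrightarrow> deg_le d (g i)) \<Longrightarrow> deg_le d (\<lambda>x. \<Sum>i\<in>A. g i x)"
  by (induction A rule: infinite_finite_induct) (auto intro: deg_le.intros)

lemma deg_le_shift: "deg_le d g \<Longrightarrow> deg_le d (\<lambda>x. g (a + x))"
  by (induction rule: deg_le.induct) (auto intro: deg_le.intros fq_affine_shift)

text \<open>In the induction on \<open>h\<close>, an affine factor \<open>L (\<iota> c * v + y) = L y + \<iota> c * M v\<close> of \<open>h\<close> is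
  moved into \<open>g\<close> or turned into a power of \<open>\<iota> c\<close>; both keep \<open>e + m + d\<close> constant.\<close>

lemma sum_span_insert_deg_le:
  assumes IH: "\<And>e g. deg_le e g \<Longrightarrow> e < k * (q - 1) \<Longrightarrow> (\<Sum>y\<in>span B. g y) = 0"
    and "deg_le d h" "deg_le e g" "e + m + d < Suc k * (q - 1)"
  shows "(\<Sum>c\<in>UNIV. \<Sum>y\<in>span B. \<iota> c ^ m * g y * h (\<iota> c * v + y)) = 0"
  using assms(2-)
proof (induction arbitrary: e g m rule: deg_le.induct)
  case (const d b)
  have "(\<Sum>c\<in>UNIV. \<iota> c ^ m) = 0 \<or> (\<Sum>y\<in>span B. g y) = 0"
  proof (cases "m < q - 1")
    case False
    then have "e < k * (q - 1)" using const by simp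
    then show ?thesis using IH const by blast
  qed (simp add: sum_emb_power)
  moreover have "(\<Sum>c\<in>UNIV. \<Sum>y\<in>span B. \<iota> c ^ m * g y * b)
      = (\<Sum>c\<in>UNIV. \<iota> c ^ m) * (\<Sum>y\<in>span B. g y) * b"
    by (simp add: sum_product sum_distrib_right)
       (simp add: sum_distrib_left sum_distrib_right)
  ultimately show ?case by auto
next
  case (add d h h')
  then show ?case by (simp add: distrib_left sum.distrib)
next
  case (affine L d h)
  obtain M where M: "\<And>x c v. L (x + \<iota> c * v) = L x + \<iota> c * M v"
    using affine.hyps by (auto simp: fq_affine_def)
  then have M': "L (\<iota> c * v + y) = L y + \<iota> c * M v" for c y v
    by (metis add.commute)
  have "(\<Sum>c\<in>UNIV. \<Sum>y\<in>span B. \<iota> c ^ m * g y * (L (\<iota> c * v + y) * h (\<iota> c * v + y)))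
     = (\<Sum>c\<in>UNIV. \<Sum>y\<in>span B. \<iota> c ^ m * (L y * g y) * h (\<iota> c * v + y))
     + M v * (\<Sum>c\<in>UNIV. \<Sum>y\<in>span B. \<iota> c ^ Suc m * g y * h (\<iota> c * v + y))"
    unfolding M' by (simp add: sum_distrib_left sum.distrib[symmetric] distrib_left distrib_right mult_ac)
  also have "\<dots> = 0"
    using affine.IH[of "Suc e" "\<lambda>y. L y * g y" m] affine.IH[of e g "Suc m"] affine.prems
      deg_le.affine[OF affine.hyps(1) affine.prems(1)] by simp
  finally show ?case .
qed

text \<open>With total degree below \<open>card B * (q - 1)\<close>, each monomial has some
  coordinate with exponent below \<open>q - 1\<close>, and the sum over that coordinate
  vanishes.\<close>

lemma sum_span_deg_le:
  assumes "independent B" "deg_le d g" "d < card B * (q - 1)"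
  shows "(\<Sum>x\<in>span B. g x) = 0"
  using finite[of B] assms
proof (induction B arbitrary: d g rule: finite_induct)
  case (insert v B)
  then have ind: "independent B" by (simp add: independent_insert)
  \<comment> \<open>The whole summand enters as \<open>h\<close>; nothing has been collected yet, so
    \<open>e = m = 0\<close> and the other factor is \<open>1\<close>.\<close>
  show ?case
    using sum_span_insert_deg_le[of "card B" B d g 0 "\<lambda>_. 1" 0 v] insert ind deg_le.const
    by (simp add: sum_span_insert)
qed simp

lemma power_q_power_diff: "(x - y :: 'b) ^ (q ^ m) = x ^ (q ^ m) - y ^ (q ^ m)"
  using power_q_power_add[of "x - y" y m] by (simp add: algebra_simps)

text \<open>The difference of powers is divisible by \<open>(M x - L x) - M x = - L x\<close>. This
  extra factor completes \<open>L x ^ (q - 1)\<close> to the affine \<open>L x ^ q\<close>, so the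
  degree drops from \<open>2 * (q - 1)\<close> to \<open>1 + (q - 2)\<close>.\<close>

lemma deg_le_row_operation:
  assumes "fq_affine L" "fq_affine M"
  shows "deg_le (q - 1) (\<lambda>x. L x ^ (q - 1) * ((M x - L x) ^ (q - 1) - M x ^ (q - 1)))"
proof -
  obtain r where r: "q = Suc (Suc r)"
    using q_gt_1 that[of "q - 2"] by simp
  have "deg_le r (\<lambda>x. (M x - L x) ^ i * M x ^ (r - i))" if "i < Suc r" for i
    using deg_le_mult[OF deg_le_power[OF deg_le_affine[OF fq_affine_diff[OF assms(2,1)]], of i]
        deg_le_power[OF deg_le_affine[OF assms(2)], of "r - i"]] that by simp
  then have "deg_le r (\<lambda>x. \<Sum>i<Suc r. (M x - L x) ^ i * M x ^ (r - i))"
    by (intro deg_le_sum) auto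
  then have "deg_le (Suc r) (\<lambda>x. - (L x ^ (q ^ 1)) * (\<Sum>i<Suc r. (M x - L x) ^ i * M x ^ (r - i)))"
    by (intro deg_le.affine fq_affine_minus fq_affine_power assms)
  moreover have "L x ^ (q - 1) * ((M x - L x) ^ (q - 1) - M x ^ (q - 1))
      = - (L x ^ (q ^ 1)) * (\<Sum>i<Suc r. (M x - L x) ^ i * M x ^ (r - i))" for x
    using diff_power_eq_sum[of "M x - L x" r "M x"] by (simp add: r mult_ac)
  ultimately show ?thesis by (simp add: r)
qed

section \<open>The product of Frobenius conjugates and its reduction\<close>

text \<open>The function of the theorem, kept as one factor per conjugate so that factors can be
  replaced one at a time.\<close>

definition moore_fun :: "nat \<Rightarrow> nat \<Rightarrow> 'b \<Rightarrow> 'b" where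
  "moore_fun l k x = (\<Prod>i<k. (x ^ (q ^ (i * l))) ^ (q - 1))"

text \<open>The linear map \<open>\<tau>\<close> of the overview; its kernel is the fixed field of
  \<open>x ^ (q ^ l)\<close>.\<close>

definition frob_diff :: "nat \<Rightarrow> 'b \<Rightarrow> 'b" where
  "frob_diff l x = x ^ (q ^ l) - x"

lemma moore_fun_0 [simp]: "moore_fun l 0 x = 1"
  by (simp add: moore_fun_def)

lemma moore_fun_Suc: "moore_fun l (Suc k) x = moore_fun l k x * (x ^ (q ^ (k * l))) ^ (q - 1)"
  by (simp add: moore_fun_def)

lemma moore_fun_eq_power: "moore_fun l k x = x ^ ((q - 1) * (\<Sum>i<k. q ^ (i * l)))"
  by (simp add: moore_fun_def power_sum power_mult[symmetric] sum_distrib_left mult.commute)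

lemma moore_fun_mult: "moore_fun l k (x * y) = moore_fun l k x * moore_fun l k y"
  by (simp add: moore_fun_eq_power power_mult_distrib)

lemma frob_diff_power:
  "frob_diff l x ^ (q ^ (i * l)) = x ^ (q ^ (Suc i * l)) - x ^ (q ^ (i * l))"
  by (simp add: frob_diff_def power_q_power_diff power_mult[symmetric] power_add)

lemma frob_diff_add: "frob_diff l (x + y) = frob_diff l x + frob_diff l y"
  by (simp add: frob_diff_def power_q_power_add)

lemma frob_diff_scale: "frob_diff l (\<iota> c * x) = \<iota> c * frob_diff l x"
  by (simp add: frob_diff_def power_mult_distrib emb_power_q_power right_diff_distrib)

lemma frob_diff_emb [simp]: "frob_diff l (\<iota> c) = 0"
  by (simp add: frob_diff_def emb_power_q_power)

lemma linear_frob_diff: "Vector_Spaces.linear (ext_scale \<iota>) (ext_scale \<iota>) (frob_diff l)"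
  by unfold_locales (auto simp: frob_diff_add frob_diff_scale ext_scale_def)

lemma deg_le_moore_fun: "deg_le (k * (q - 1)) (moore_fun l k)"
proof -
  have "deg_le (q - 1) (\<lambda>x. (x ^ (q ^ (i * l))) ^ (q - 1))" for i
    using deg_le_power[OF deg_le_affine[OF fq_affine_power[OF fq_affine_id]]] by simp
  then show ?thesis
    using deg_le_prod[of "{..<k}"] by (simp add: moore_fun_def[abs_def])
qed

text \<open>Each product alone has degree bound \<open>Suc k * (q - 1)\<close>. In the induction the
  old error is multiplied by the new factor, and a row operation on the last two conjugates supplies
  the rest.\<close>

lemma deg_le_moore_fun_Suc:
  "deg_le (k * (q - 1)) (\<lambda>x. x ^ (q - 1) * moore_fun l k (frob_diff l x) - moore_fun l (Suc k) x)"
proof (induction k)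
  case 0
  then show ?case using deg_le.const[of 0 0] by (simp add: moore_fun_Suc)
next
  case (Suc k)
  let ?s = "\<lambda>i x. x ^ (q ^ (i * l))"
  have aff: "fq_affine (?s i)" for i
    by (intro fq_affine_power fq_affine_id)
  have "deg_le (q - 1) (\<lambda>x. (?s (Suc k) x - ?s k x) ^ (q - 1))"
    using deg_le_power[OF deg_le_affine[OF fq_affine_diff[OF aff[of "Suc k"] aff[of k]]], where m="q - 1"] by simp
  from deg_le_mult[OF Suc this]
    deg_le_mult[OF deg_le_moore_fun[of k l] deg_le_row_operation[OF aff[of k] aff[of "Suc k"]]]
  have "deg_le (k * (q - 1) + (q - 1)) (\<lambda>x.
      (x ^ (q - 1) * moore_fun l k (frob_diff l x) - moore_fun l (Suc k) x)
        * (?s (Suc k) x - ?s k x) ^ (q - 1)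
      + moore_fun l k x * (?s k x ^ (q - 1)
        * ((?s (Suc k) x - ?s k x) ^ (q - 1) - ?s (Suc k) x ^ (q - 1))))"
    by (rule deg_le.add)
  \<comment> \<open>Here \<open>a = x ^ (q - 1)\<close>, \<open>p = moore_fun l k x\<close> and
    \<open>m\<close> is the same product at \<open>frob_diff l x\<close>; \<open>s\<close>,
    \<open>u\<close>, \<open>t\<close> are the powers with exponent \<open>q - 1\<close> of
    \<open>?s k x\<close>, of \<open>?s (Suc k) x\<close> and of their difference.\<close>
  moreover have "(a * m - p * s) * t + p * (s * (t - u)) = a * (m * t) - p * s * u"
    for a m p s t u :: 'b
    by (simp add: algebra_simps)
  ultimately show ?case
    unfolding moore_fun_Suc frob_diff_power by (simp only: mult_Suc add.commute)
qed

lemma sum_moore_fun_reduce: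
  assumes "independent (insert 1 B)" "1 \<notin> B"
  shows "(\<Sum>x\<in>span (insert 1 B). moore_fun l (Suc (card B)) (a + x))
       = - (\<Sum>y\<in>span B. moore_fun l (card B) (frob_diff l (a + y)))"
proof -
  let ?k = "card B"
  let ?g = "\<lambda>x. x ^ (q - 1) * moore_fun l ?k (frob_diff l x)"
  have fin: "finite B" by simp
  \<comment> \<open>The error has degree \<open>?k * (q - 1)\<close>, too small for a space of
    dimension \<open>Suc ?k\<close>.\<close>
  have "(\<Sum>x\<in>span (insert 1 B). ?g (a + x) - moore_fun l (Suc ?k) (a + x)) = 0"
    using sum_span_deg_le[OF assms(1) deg_le_shift[OF deg_le_moore_fun_Suc[of ?k l], of a]]
      assms(2) fin q_gt_1 by simp
  then have "(\<Sum>x\<in>span (insert 1 B). moore_fun l (Suc ?k) (a + x))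
      = (\<Sum>x\<in>span (insert 1 B). ?g (a + x))"
    by (simp add: sum_subtractf)
  \<comment> \<open>\<open>frob_diff\<close> kills \<open>\<iota> c\<close>, so \<open>c\<close>
    remains only in the first factor.\<close>
  also have "\<dots> = (\<Sum>c\<in>UNIV. \<Sum>y\<in>span B.
      ((a + y) + \<iota> c) ^ (q - 1) * moore_fun l ?k (frob_diff l (a + y)))"
    by (simp add: sum_span_insert[OF assms] frob_diff_add add_ac)
  also have "\<dots> = (\<Sum>y\<in>span B. (\<Sum>c\<in>UNIV. ((a + y) + \<iota> c) ^ (q - 1))
      * moore_fun l ?k (frob_diff l (a + y)))"
    by (subst sum.swap) (simp add: sum_distrib_right)
  also have "\<dots> = - (\<Sum>y\<in>span B. moore_fun l ?k (frob_diff l (a + y)))"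
    unfolding sum_emb_shift_power by (simp add: sum_negf)
  finally show ?thesis .
qed

lemma linear_mult: "Vector_Spaces.linear (ext_scale \<iota>) (ext_scale \<iota>) (\<lambda>x. u * x)"
  by unfold_locales (auto simp: ext_scale_def algebra_simps)

lemma sum_moore_fun_nonzero:
  assumes ker: "\<And>x. frob_diff l x = 0 \<Longrightarrow> x \<in> range \<iota>" and "independent B"
  shows "(\<Sum>x\<in>span B. moore_fun l (card B) (a + x)) \<noteq> 0"
  using assms(2)
proof (induction "card B" arbitrary: a B)
  case 0
  then have "B = {}" by simp
  then show ?case by simp
next
  case (Suc k)
  then obtain v B0 where B: "B = insert v B0" "v \<notin> B0" "card B0 = k"
    by (metis card_Suc_eq)
  have v: "v \<noteq> 0"
    using Suc.prems B dependent_zero by blast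
  \<comment> \<open>Scaling \<open>v\<close> to \<open>1\<close> makes
    \<open>sum_moore_fun_reduce\<close> applicable; by multiplicativity it changes the sum only by a
    constant factor.\<close>
  define f where "f x = inverse v * x" for x
  have lf: "Vector_Spaces.linear (ext_scale \<iota>) (ext_scale \<iota>) f"
    unfolding f_def[abs_def] by (rule linear_mult)
  have injf: "inj f"
    using v by (auto simp: f_def inj_def)
  define C where "C = f ` B0"
  have fB: "f ` B = insert 1 C"
    using v by (simp add: B C_def f_def)
  have C1: "1 \<notin> C"
    using B(2) v by (auto simp: C_def f_def field_simps)
  have cardC: "card C = k"
    using B(3) card_image[OF inj_on_subset[OF injf]] by (auto simp: C_def)
  have indC: "independent (insert 1 C)"
    using linear_independent_injective_image[OF lf Suc.prems inj_on_subset[OF injf]] fB by auto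
  then have C: "independent C" "1 \<notin> span C"
    using C1 by (auto simp: independent_insert)
  \<comment> \<open>The kernel lies in \<open>range \<iota>\<close>, the line through
    \<open>1\<close>, which meets \<open>span C\<close> only in \<open>0\<close>.\<close>
  have inj: "inj_on (frob_diff l) (span C)"
  proof (rule inj_onI)
    fix x y assume xy: "x \<in> span C" "y \<in> span C" and "frob_diff l x = frob_diff l y"
    then have "frob_diff l (x - y) = 0"
      using linear_diff[OF linear_frob_diff] by simp
    then obtain c where c: "x - y = \<iota> c" using ker by blast
    have mem: "\<iota> c \<in> span C" using span_diff[OF xy] c by simp
    have "c = 0"
    proof (rule ccontr)
      assume "c \<noteq> 0"
      then have "ext_scale \<iota> (inverse c) (\<iota> c) = 1"
        by (simp add: ext_scale_def emb_mult[symmetric])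
      then show False using span_scale[OF mem, of "inverse c"] C(2) by simp
    qed
    with c show "x = y" by simp
  qed
  \<comment> \<open>The image has dimension \<open>k\<close> again, and the new translate is
    \<open>frob_diff l (f a)\<close>; hence the induction over arbitrary \<open>a\<close>.\<close>
  let ?D = "frob_diff l ` C"
  have D: "independent ?D" "card ?D = k"
    using linear_independent_injective_image[OF linear_frob_diff C(1) inj] cardC
      card_image[OF inj_on_subset[OF inj span_superset]] by auto
  have spanD: "span ?D = frob_diff l ` span C"
    by (rule linear_span_image[OF linear_frob_diff])
  have "(\<Sum>x\<in>span (insert 1 C). moore_fun l (Suc k) (f a + x))
      = - (\<Sum>y\<in>span C. moore_fun l k (frob_diff l (f a) + frob_diff l y))"
    using sum_moore_fun_reduce[OF indC C1, of l "f a"] by (simp add: cardC frob_diff_add)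
  also have "\<dots> = - (\<Sum>z\<in>span ?D. moore_fun l k (frob_diff l (f a) + z))"
    unfolding spanD by (simp add: sum.reindex[OF inj])
  also have "\<dots> \<noteq> 0"
    using Suc.hyps(1)[of ?D "frob_diff l (f a)"] D by simp
  finally have nz: "(\<Sum>x\<in>span (insert 1 C). moore_fun l (Suc k) (f a + x)) \<noteq> 0" .
  have "(\<Sum>x\<in>span (insert 1 C). moore_fun l (Suc k) (f a + x))
      = (\<Sum>x\<in>span B. moore_fun l (Suc k) (f (a + x)))"
    unfolding fB[symmetric] linear_span_image[OF lf]
    by (subst sum.reindex) (auto intro: inj_on_subset[OF injf] simp: f_def algebra_simps)
  also have "\<dots> = moore_fun l (Suc k) (inverse v) * (\<Sum>x\<in>span B. moore_fun l (Suc k) (a + x))"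
    by (simp add: f_def moore_fun_mult sum_distrib_left)
  finally show ?case using nz Suc.hyps(2) by auto
qed

lemma sum_moore_fun_zero:
  assumes "independent B" "1 \<in> B" "t \<in> B" "t \<noteq> 1" "frob_diff l t = 0"
  shows "(\<Sum>x\<in>span B. moore_fun l (card B) x) = 0"
proof -
  define D where "D = B - {1, t}"
  define C where "C = insert t D"
  have C: "B = insert 1 C" "1 \<notin> C" "t \<notin> D"
    using assms by (auto simp: C_def D_def)
  have indC: "independent (insert t D)"
    using assms(1) C by (simp add: C_def independent_insert)
  \<comment> \<open>As \<open>frob_diff l t = 0\<close>, the summand is constant in direction
    \<open>t\<close>: every term occurs \<open>q\<close> times, and \<open>q\<close> is zero in the
    field.\<close>
  have "(\<Sum>y\<in>span C. moore_fun l (card C) (frob_diff l y))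
      = (\<Sum>c\<in>(UNIV::'a set). \<Sum>z\<in>span D. moore_fun l (card C) (frob_diff l z))"
    unfolding C_def by (simp add: sum_span_insert[OF indC C(3)] frob_diff_add frob_diff_scale assms(5))
  also have "\<dots> = 0"
    by (simp add: q)
  finally show ?thesis
    using sum_moore_fun_reduce[of C l 0] assms(1) C by simp
qed

section \<open>Fixed points of Frobenius powers\<close>

text \<open>\<open>range \<iota>\<close> already supplies \<open>q\<close> roots of
  \<open>X ^ q - X\<close>, which has at most \<open>q\<close>.\<close>

lemma range_emb_iff: "x \<in> range \<iota> \<longleftrightarrow> x ^ q = x"
proof -
  let ?p = "monom (1::'b) q - monom 1 1"
  let ?R = "{x. poly ?p x = 0}"
  have "coeff ?p q = 1" using q_gt_1 by simp
  then have "?p \<noteq> 0" by (metis coeff_0 zero_neq_one)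
  then have "card ?R \<le> degree ?p" by (rule card_poly_roots_bound)
  also have "\<dots> \<le> q"
    using q_gt_1 by (intro degree_diff_le) (auto simp: degree_monom_eq)
  also have "\<dots> = card (range \<iota>)" using card_image[OF inj_emb] q by simp
  finally have "range \<iota> = ?R"
    by (intro card_seteq) (auto simp: poly_monom emb_power_q)
  then show ?thesis by (auto simp: poly_monom)
qed

lemma power_q_fixed_mult: "x ^ (q ^ m) = x \<Longrightarrow> (x::'b) ^ (q ^ (m * j)) = x"
  by (induction j) (auto simp: power_add power_mult)

text \<open>By Bezout, the power map for \<open>l * a\<close> is the one for \<open>n * b\<close>
  followed by the one for \<open>gcd l n\<close>; the first two fix \<open>x\<close>.\<close>

lemma power_q_fixed_gcd:
  assumes "(x::'b) ^ (q ^ l) = x" "x ^ (q ^ n) = x" "l \<noteq> 0"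
  shows "x ^ (q ^ gcd l n) = x"
proof -
  obtain a b where ab: "l * a = n * b + gcd l n"
    using bezout_nat[OF assms(3)] by blast
  have "x = x ^ (q ^ (l * a))" using power_q_fixed_mult[OF assms(1)] by simp
  also have "\<dots> = (x ^ (q ^ (n * b))) ^ (q ^ gcd l n)" by (simp add: ab power_add power_mult)
  also have "\<dots> = x ^ (q ^ gcd l n)" using power_q_fixed_mult[OF assms(2)] by simp
  finally show ?thesis by simp
qed

lemma power_q_power_card:
  assumes "CARD('b) = q ^ n"
  shows "(x::'b) ^ (q ^ n) = x"
proof (cases "x = 0")
  case False
  have "x ^ (q ^ n) = x * x ^ (q ^ n - 1)"
    using q_gt_1 by (subst power_Suc[symmetric]) simp
  with finite_field_power_card_minus_1[OF False] show ?thesis by (simp add: assms)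
qed (use q_gt_1 in auto)

text \<open>\<open>t = g ^ N\<close> with \<open>N = (q ^ n - 1) / (q ^ d - 1)\<close>, where \<open>g\<close> avoids the fewer than
  \<open>q ^ n - 1\<close> roots of \<open>X ^ (N * (q - 1)) - 1\<close>.\<close>

lemma exists_fixed_not_emb:
  assumes "CARD('b) = q ^ n" "d dvd n" "d > 1" "n > 0"
  shows "\<exists>t::'b. t ^ (q ^ d) = t \<and> t \<notin> range \<iota>"
proof -
  obtain e where e: "n = d * e" using assms(2) by blast
  have "q ^ d - 1 dvd (q ^ d) ^ e - 1"
  proof -
    have "int (q ^ d) - 1 dvd int (q ^ d) ^ e - 1"
      by (simp add: power_diff_1_eq)
    moreover have "int (q ^ d - 1) = int (q ^ d) - 1" "int ((q ^ d) ^ e - 1) = int (q ^ d) ^ e - 1"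
      using q_gt_1 by (simp_all add: of_nat_diff)
    ultimately show ?thesis by (metis int_dvd_int_iff)
  qed
  then obtain N where N: "q ^ n - 1 = (q ^ d - 1) * N"
    by (auto simp: e power_mult)
  have qd: "q < q ^ d" using q_gt_1 assms(3) power_strict_increasing[of 1 d q] by simp
  have qn: "q ^ n > 1" using q_gt_1 assms(4) by (rule one_less_power)
  have "N > 0" using N qn by (cases N) auto
  then have "0 < N * (q - 1)" "N * (q - 1) < CARD('b) - 1"
    unfolding assms(1) N using qd q_gt_1 by (auto simp: mult.commute diff_less_mono)
  then obtain g :: 'b where g: "g \<noteq> 0" "g ^ (N * (q - 1)) \<noteq> 1"
    using exists_power_neq_1 by blast
  let ?t = "g ^ N"
  have "?t ^ (q ^ d) = ?t * ?t ^ (q ^ d - 1)"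
    using q_gt_1 by (subst power_Suc[symmetric]) simp
  also have "?t ^ (q ^ d - 1) = 1"
    using finite_field_power_card_minus_1[OF g(1)] unfolding assms(1) N
    by (simp add: power_mult[symmetric] mult.commute)
  finally have "?t ^ (q ^ d) = ?t" by simp
  moreover have "?t ^ q = ?t * ?t ^ (q - 1)"
    using q_gt_1 by (subst power_Suc[symmetric]) simp
  then have "?t ^ q \<noteq> ?t"
    using g by (simp add: power_mult)
  ultimately show ?thesis using range_emb_iff by blast
qed

section \<open>The equivalence with coprimality\<close>

lemma order_sum_free_moore_fun_iff:
  assumes "CARD('b) = q ^ n" "n > 0" "l > 0" "2 \<le> k" "k \<le> n"
  shows "order_sum_free \<iota> k (moore_fun l k) \<longleftrightarrow> gcd l n = 1"
proof
  assume gcd: "gcd l n = 1"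
  have ker: "x \<in> range \<iota>" if "frob_diff l x = 0" for x
    using power_q_fixed_gcd[of x l n] power_q_power_card[OF assms(1), of x] that assms(3) gcd
    by (simp add: range_emb_iff frob_diff_def)
  show "order_sum_free \<iota> k (moore_fun l k)"
    unfolding order_sum_free_def affine_subspace_of_dim_def
  proof (intro allI impI, elim exE conjE)
    fix A V a
    assume V: "subspace V" "dim V = k" and A: "A = (\<lambda>v. a + v) ` V"
    obtain B where B: "B \<subseteq> V" "independent B" "V \<subseteq> span B" "card B = dim V"
      by (rule basis_exists)
    have "V = span B" using B V(1) span_minimal by blast
    then show "(\<Sum>x\<in>A. moore_fun l k x) \<noteq> 0"
      using sum_moore_fun_nonzero[OF ker B(2), where a=a] B(4) V(2) A
      by (simp add: sum.reindex)
  qed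
next
  assume free: "order_sum_free \<iota> k (moore_fun l k)"
  show "gcd l n = 1"
  proof (rule ccontr)
    assume "gcd l n \<noteq> 1"
    then have "gcd l n > 1" using assms(2) by (metis One_nat_def Suc_lessI gcd_pos_nat not_gr_zero)
    then obtain t :: 'b where t: "t ^ (q ^ gcd l n) = t" "t \<notin> range \<iota>"
      using exists_fixed_not_emb[OF assms(1), of "gcd l n"] assms(2) by auto
    obtain j where j: "l = gcd l n * j" by (meson gcd_dvd1 dvdE)
    then have ft: "frob_diff l t = 0"
      using power_q_fixed_mult[OF t(1), of j] by (simp add: frob_diff_def)
    have "t \<noteq> 1" using t(2) by (metis emb_1 rangeI)
    have "t \<notin> span {1}"
      using t(2) by (auto simp: span_singleton ext_scale_def)
    then have ind: "independent {t, 1}"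
      by (intro independent_insertI independent_empty) auto
    obtain B where B: "{t, 1} \<subseteq> B" "B \<subseteq> UNIV" "independent B" "UNIV \<subseteq> span B"
      by (rule maximal_independent_subset_extend[OF subset_UNIV ind])
    have "span B = UNIV" using B(4) by blast
    then have "card B = n"
      using card_span[OF B(3)] assms(1) q_gt_1 by simp
    \<comment> \<open>The independent pair \<open>t\<close>, \<open>1\<close> sits in a basis of
      size \<open>n\<close>, so \<open>2 \<le> k \<le> n\<close> leaves room for a set of exactly
      \<open>k\<close> basis vectors containing both.\<close>
    then obtain C where C: "{t, 1} \<subseteq> C" "C \<subseteq> B" "card C = k"
      using exists_subset_between[of "{t, 1}" k B] assms(4,5) B(1) \<open>t \<noteq> 1\<close> by auto
    have indC: "independent C" using independent_mono[OF B(3) C(2)] .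
    have "affine_subspace_of_dim \<iota> k (span C)"
      unfolding affine_subspace_of_dim_def
      using indC C(3) by (intro exI[of _ "span C"] exI[of _ 0]) (simp add: dim_eq_card_independent)
    moreover have "(\<Sum>x\<in>span C. moore_fun l k x) = 0"
      using sum_moore_fun_zero[OF indC _ _ \<open>t \<noteq> 1\<close> ft] C by auto
    ultimately show False using free by (auto simp: order_sum_free_def)
  qed
qed

end

theorem corollary2p8:
  fixes \<iota> :: "'a::{field,finite} \<Rightarrow> 'b::{field,finite}"
    and q n k l :: nat
  assumes "primepow q" and "CARD('a) = q"
    and "n > 0" and "k > 0" and "l > 0"
    and "CARD('b) = q ^ n"
    and "field_embedding \<iota>"
    and "2 \<le> k" and "k \<le> n"
  shows "order_sum_free \<iota> k (\<lambda>x. x ^ ((q - 1) * (\<Sum>i<k. q ^ (i * l)))) \<longleftrightarrow> gcd l n = 1"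
proof -
  interpret finite_extension \<iota> q
    using assms by unfold_locales
  show ?thesis
    using order_sum_free_moore_fun_iff[of n l k] assms by (simp add: moore_fun_eq_power[abs_def])
qed

end
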